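(* Let $a<b$ be real numbers and let $f\in C^6[a,b]$ be $5$-convex or $5$-concave. Then for every integer $n\ge 1$, \[ \left|\int_a^b f(x)\,dx - Q_n[f;a,b]\right| \le \frac14\,\bigl|\mathcal{L}_n[f;a,b]-\mathcal{G}_n[f;a,b]\bigr|. \]
   Context: Higher-order convexity: a function $f\colon[a,b]\to\mathbb{R}$ is $n$-convex if $[x_0,x_1,\dots,x_{n+1};f]\ge 0$ for all pairwise distinct $x_0,\dots,x_{n+1}\in[a,b]$, where divided differences are defined recursively by $[x_0;f]=f(x_0)$ and \[ [x_0,\dots,x_{k};f]=\frac{[x_1,\dots,x_{k};f]-[x_0,\dots,x_{k-1};f]}{x_{k}-x_0}. \] $f$ is $n$-concave if $-f$ is $n$-convex. For $f\in C^6[a,b]$, being $5$-convex (respectively $5$-concave) means that $f^{(6)}\ge 0$ (respectively $f^{(6)}\le 0$) on $[a,b]$. Three-point Gauss quadrature: \[ \mathcal{G}[f;a,b]=\frac{b-a}{18}\left[5f\left(\tfrac{5+\sqrt{15}}{10}a+\tfrac{5-\sqrt{15}}{10}b\right)+8f\left(\tfrac{a+b}{2}\right)+5f\left(\tfrac{5-\sqrt{15}}{10}a+\tfrac{5+\sqrt{15}}{10}b\right)\right]. \] Four-point Lobatto quadrature: \[ \mathcal{L}[f;a,b]=\frac{b-a}{12}\left[f(a)+5f\left(\tfrac{5+\sqrt{5}}{10}a+\tfrac{5-\sqrt{5}}{10}b\right)+5f\left(\tfrac{5-\sqrt{5}}{10}a+\tfrac{5+\sqrt{5}}{10}b\right)+f(b)\right].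 \] Define $Q[f;a,b]=\frac34\mathcal{G}[f;a,b]+\frac14\mathcal{L}[f;a,b]$. Composite rules: for an integer $n\ge 1$, divide $[a,b]$ into $n$ subintervals of equal length by points $a=x_0<x_1<\dots<x_n=b$ and set $\mathcal{G}_n[f;a,b]=\sum_{k=1}^n\mathcal{G}[f;x_{k-1},x_k]$, $\mathcal{L}_n[f;a,b]=\sum_{k=1}^n\mathcal{L}[f;x_{k-1},x_k]$, $Q_n[f;a,b]=\sum_{k=1}^n Q[f;x_{k-1},x_k]$. *)

theory Defs
  imports "HOL-Analysis.Analysis"
begin

text \<open>\<open>divided_difference f x k i\<close> is $[x_i, \dots, x_{i+k}; f]$ for a sequence of nodes \<open>x\<close>.\<close>

primrec divided_difference :: "(real \<Rightarrow> real) \<Rightarrow> (nat \<Rightarrow> real) \<Rightarrow> nat \<Rightarrow> nat \<Rightarrow> real" where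
  "divided_difference f x 0 i = f (x i)"
| "divided_difference f x (Suc k) i =
     (divided_difference f x k (Suc i) - divided_difference f x k i) / (x (i + Suc k) - x i)"

definition higher_convex_on :: "nat \<Rightarrow> real set \<Rightarrow> (real \<Rightarrow> real) \<Rightarrow> bool" where
  "higher_convex_on n S f \<longleftrightarrow>
     (\<forall>x. inj_on x {0..n+1} \<and> x ` {0..n+1} \<subseteq> S \<longrightarrow> divided_difference f x (n+1) 0 \<ge> 0)"

definition higher_concave_on :: "nat \<Rightarrow> real set \<Rightarrow> (real \<Rightarrow> real) \<Rightarrow> bool" where
  "higher_concave_on n S f \<longleftrightarrow> higher_convex_on n S (\<lambda>t. - f t)"

text \<open>The class $C^k(S)$. Derivatives are taken within \<open>S\<close>, hence are one-sided at the endpoints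
  of a closed interval; values of \<open>f\<close> outside \<open>S\<close> are irrelevant.\<close>

primrec Ck_on :: "nat \<Rightarrow> real set \<Rightarrow> (real \<Rightarrow> real) \<Rightarrow> bool" where
  "Ck_on 0 S f \<longleftrightarrow> continuous_on S f"
| "Ck_on (Suc k) S f \<longleftrightarrow>
     (\<exists>f'. (\<forall>x\<in>S. (f has_real_derivative f' x) (at x within S)) \<and> Ck_on k S f')"

definition gauss3 :: "(real \<Rightarrow> real) \<Rightarrow> real \<Rightarrow> real \<Rightarrow> real" where
  "gauss3 f a b = (b - a) / 18 *
     (5 * f ((5 + sqrt 15) / 10 * a + (5 - sqrt 15) / 10 * b)
    + 8 * f ((a + b) / 2)
    + 5 * f ((5 - sqrt 15) / 10 * a + (5 + sqrt 15) / 10 * b))"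

definition lobatto4 :: "(real \<Rightarrow> real) \<Rightarrow> real \<Rightarrow> real \<Rightarrow> real" where
  "lobatto4 f a b = (b - a) / 12 *
     (f a
    + 5 * f ((5 + sqrt 5) / 10 * a + (5 - sqrt 5) / 10 * b)
    + 5 * f ((5 - sqrt 5) / 10 * a + (5 + sqrt 5) / 10 * b)
    + f b)"

definition quad_Q :: "(real \<Rightarrow> real) \<Rightarrow> real \<Rightarrow> real \<Rightarrow> real" where
  "quad_Q f a b = 3 / 4 * gauss3 f a b + 1 / 4 * lobatto4 f a b"

definition grid_point :: "nat \<Rightarrow> real \<Rightarrow> real \<Rightarrow> nat \<Rightarrow> real" where
  "grid_point n a b k = a + real k * (b - a) / real n"

definition composite ::
  "((real \<Rightarrow> real) \<Rightarrow> real \<Rightarrow> real \<Rightarrow> real) \<Rightarrow> nat \<Rightarrow> (real \<Rightarrow> real) \<Rightarrow> real \<Rightarrow> real \<Rightarrow> real" where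
  "composite R n f a b = (\<Sum>k=1..n. R f (grid_point n a b (k - 1)) (grid_point n a b k))"

end

theory Submission
  imports Defs
begin

text \<open>On a single interval the claim reads G \<open>\<le>\<close> I and 2 I \<open>\<le>\<close> G + L when the sixth derivative is
  nonnegative. Folding the interval at its midpoint, i.e. passing to
  \<open>h s = r * (f (m + r * s) + f (m - r * s))\<close> on \<open>[0,1]\<close>, kills all odd derivatives at 0, so
  Taylor's formula with integral remainder turns both inequalities into the nonnegativity of an
  explicit Peano kernel on \<open>[0,1]\<close>. The sign of the sixth derivative is read off from divided
  differences at equidistant nodes. Both inequalities are preserved by summation, and they say
  precisely that the integral differs from Q by at most (L - G)/4.\<close>

subsection \<open>Divided differences and the sign of the top derivative\<close>

lemma divided_difference_diff:
  "divided_difference (\<lambda>t. f t - g t) x k i = divided_difference f x k i - divided_difference g x k i"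
proof (induction k arbitrary: i)
  case 0
  then show ?case by simp
next
  case (Suc k)
  show ?case by (simp add: Suc diff_divide_distrib)
qed

lemma divided_difference_shift:
  assumes "\<And>i. x (Suc i) = x i + h"
  shows "divided_difference f x k (Suc i) = divided_difference (\<lambda>t. f (t + h)) x k i"
proof (induction k arbitrary: i)
  case 0
  then show ?case by (simp add: assms)
next
  case (Suc k)
  have "x (Suc i + Suc k) - x (Suc i) = x (i + Suc k) - x i"
    by (simp add: assms)
  then show ?case by (simp only: divided_difference.simps Suc)
qed

text \<open>With equal spacing the denominator depends only on the order, so the outermost
  difference can be moved into the function as a forward difference.\<close>

lemma divided_difference_equidistant_Suc:
  fixes u h :: real
  defines "x \<equiv> \<lambda>i. u + real i * h"
  shows "divided_difference f x (Suc k) i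
     = divided_difference (\<lambda>t. f (t + h) - f t) x k i / (real (Suc k) * h)"
proof -
  have s: "\<And>i. x (Suc i) = x i + h" by (simp add: x_def algebra_simps)
  have "x (i + Suc k) - x i = real (Suc k) * h"
    by (simp add: x_def algebra_simps)
  then show ?thesis
    by (simp only: divided_difference.simps divided_difference_shift[where x = x and h = h, OF s] divided_difference_diff)
qed

text \<open>Induction trades one order for a forward difference with step \<open>h\<close>, on an
  interval shortened by \<open>h\<close>. The mean value theorem turns the sign of
  \<open>D (Suc k)\<close> into that of the differenced \<open>D k\<close>.\<close>

lemma divided_difference_equidistant_neg:
  fixes u v h :: real
  assumes "h > 0" and "u + real k * h \<le> v"
    and "\<And>j t. j < k \<Longrightarrow> t \<in> {u..v} \<Longrightarrow> (D j has_real_derivative D (Suc j) t) (at t within {u..v})"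
    and "\<And>t. t \<in> {u..v} \<Longrightarrow> D k t < 0"
  shows "divided_difference (D 0) (\<lambda>i. u + real i * h) k 0 < 0"
  using assms(2-)
proof (induction k arbitrary: D v)
  case 0
  then show ?case by simp
next
  case (Suc k)
  define E where "E = (\<lambda>j t. D j (t + h) - D j t)"
  have "divided_difference (E 0) (\<lambda>i. u + real i * h) k 0 < 0"
  proof (rule Suc.IH)
    show "u + real k * h \<le> v - h" using Suc.prems(1) by (simp add: algebra_simps)
  next
    fix j t assume j: "j < k" and t: "t \<in> {u..v - h}"
    have 1: "(D j has_real_derivative D (Suc j) t) (at t within {u..v - h})"
      by (rule has_field_derivative_subset[OF Suc.prems(2)]) (use j t \<open>h > 0\<close> in auto)
    have "(D j has_real_derivative D (Suc j) (t + h)) (at (t + h) within (\<lambda>t. t + h) ` {u..v - h})"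
      by (rule has_field_derivative_subset[OF Suc.prems(2)]) (use j t \<open>h > 0\<close> in auto)
    moreover have "((\<lambda>t. t + h) has_real_derivative 1) (at t within {u..v - h})"
      by (auto intro!: derivative_eq_intros)
    ultimately have "(D j \<circ> (\<lambda>t. t + h) has_real_derivative D (Suc j) (t + h) * 1) (at t within {u..v - h})"
      by (rule DERIV_image_chain)
    then have 2: "((\<lambda>t. D j (t + h)) has_real_derivative D (Suc j) (t + h)) (at t within {u..v - h})"
      by (simp add: o_def)
    show "(E j has_real_derivative E (Suc j) t) (at t within {u..v - h})"
      unfolding E_def using 1 2 by (rule DERIV_diff[rotated])
  next
    fix t assume t: "t \<in> {u..v - h}"
    have "\<exists>z\<in>{t<..<t + h}. D k (t + h) - D k t = (\<lambda>y. D (Suc k) z * y) (t + h - t)"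
    proof (rule mvt_simple)
      show "t < t + h" using \<open>h > 0\<close> by simp
      fix z assume z: "t \<le> z" "z \<le> t + h"
      then have "(D k has_real_derivative D (Suc k) z) (at z within {t..t + h})"
        using t \<open>h > 0\<close> by (intro has_field_derivative_subset[OF Suc.prems(2)]) auto
      then show "(D k has_derivative (\<lambda>y. D (Suc k) z * y)) (at z within {t..t + h})"
        by (simp add: has_field_derivative_def)
    qed
    then obtain z where "z \<in> {t<..<t + h}" "D k (t + h) - D k t = D (Suc k) z * h" by auto
    then show "E k t < 0"
      using Suc.prems(3)[of z] t \<open>h > 0\<close> by (simp add: E_def mult_neg_pos)
  qed
  then show ?case
    unfolding divided_difference_equidistant_Suc E_def
    using \<open>h > 0\<close> by (simp add: divide_neg_pos)
qed

text \<open>If the derivative were negative at \<open>c\<close>, continuity would make it negative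
  on a short interval around \<open>c\<close>, and equidistant nodes there would contradict
  convexity.\<close>

lemma higher_convex_on_imp_deriv_nonneg:
  fixes a b :: real
  assumes "a < b" and convex: "higher_convex_on n {a..b} (D 0)"
    and deriv: "\<And>j t. j < Suc n \<Longrightarrow> t \<in> {a..b} \<Longrightarrow>
      (D j has_real_derivative D (Suc j) t) (at t within {a..b})"
    and cont: "continuous_on {a..b} (D (Suc n))" and c: "c \<in> {a..b}"
  shows "D (Suc n) c \<ge> 0"
proof (rule ccontr)
  assume "\<not> ?thesis"
  then have neg: "D (Suc n) c < 0" by simp
  obtain d where d: "d > 0"
    "\<And>t. t \<in> {a..b} \<Longrightarrow> dist t c < d \<Longrightarrow> dist (D (Suc n) t) (D (Suc n) c) < - D (Suc n) c"
    using cont c neg unfolding continuous_on_iff by (metis neg_0_less_iff_less)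
  \<comment> \<open>Clipping handles an endpoint \<open>c\<close>; the radius \<open>d / 2\<close>
    keeps the closed interval inside the open ball.\<close>
  define u v where "u = max a (c - d / 2)" and "v = min b (c + d / 2)"
  have "u < v" and sub: "{u..v} \<subseteq> {a..b}"
    using \<open>a < b\<close> c d(1) by (auto simp: u_def v_def)
  have negs: "D (Suc n) t < 0" if "t \<in> {u..v}" for t
  proof -
    have "dist t c < d" using that d(1) by (auto simp: u_def v_def dist_real_def)
    then have "\<bar>D (Suc n) t - D (Suc n) c\<bar> < - D (Suc n) c"
      using d(2) that sub by (auto simp: dist_real_def)
    then show ?thesis by linarith
  qed
  \<comment> \<open>The \<open>n + 2\<close> nodes leave \<open>Suc n\<close> gaps, so the last node
    is exactly \<open>v\<close>.\<close>
  define h where "h = (v - u) / real (Suc n)"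
  have h: "h > 0" and uv: "u + real (Suc n) * h = v"
    using \<open>u < v\<close> by (simp_all add: h_def)
  let ?x = "\<lambda>i. u + real i * h"
  have "?x i \<in> {u..v}" if "i \<le> Suc n" for i
  proof -
    have "real i * h \<le> real (Suc n) * h" using that h by (intro mult_right_mono) auto
    then have "u + real i * h \<le> v" using uv by linarith
    then show ?thesis using h by simp
  qed
  then have "?x ` {0..n + 1} \<subseteq> {u..v}" by (intro image_subsetI) simp
  then have "?x ` {0..n + 1} \<subseteq> {a..b}" using sub by (rule order_trans)
  moreover have "inj_on ?x {0..n + 1}" using h by (auto simp: inj_on_def)
  ultimately have "divided_difference (D 0) ?x (n + 1) 0 \<ge> 0"
    using convex unfolding higher_convex_on_def by blast
  moreover have "divided_difference (D 0) ?x (Suc n) 0 < 0"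
  proof (rule divided_difference_equidistant_neg[OF h, where v = v])
    show "u + real (Suc n) * h \<le> v" using uv by simp
    show "(D j has_real_derivative D (Suc j) t) (at t within {u..v})" if "j < Suc n" "t \<in> {u..v}" for j t
      using has_field_derivative_subset[OF deriv sub] that sub by blast
  qed (rule negs)
  ultimately show False by simp
qed

text \<open>Collects the nested existential witnesses of \<open>Ck_on\<close> into one sequence;
  \<open>case_nat\<close> prepends the function to the sequence of its derivative.\<close>

lemma Ck_on_derivatives:
  assumes "Ck_on k S f"
  obtains D where "D 0 = f"
    and "\<And>j x. j < k \<Longrightarrow> x \<in> S \<Longrightarrow> (D j has_real_derivative D (Suc j) x) (at x within S)"
    and "continuous_on S (D k)"
  using assms
proof (induction k arbitrary: f thesis)
  case 0
  then show ?case using "0.prems"(1)[of "\<lambda>_. f"] by simp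
next
  case (Suc k)
  then obtain f' where f': "\<And>x. x \<in> S \<Longrightarrow> (f has_real_derivative f' x) (at x within S)"
    and "Ck_on k S f'" by auto
  from Suc.IH[OF _ this(2)] obtain D where D: "D 0 = f'"
    "\<And>j x. j < k \<Longrightarrow> x \<in> S \<Longrightarrow> (D j has_real_derivative D (Suc j) x) (at x within S)"
    "continuous_on S (D k)" by blast
  show ?case
  proof (rule Suc.prems(1)[of "case_nat f D"])
    fix j x assume "j < Suc k" "x \<in> S"
    then show "(case_nat f D j has_real_derivative case_nat f D (Suc j) x) (at x within S)"
      using f' D by (cases j) auto
  qed (use D in auto)
qed

subsection \<open>The Peano kernels\<close>

text \<open>This is 720 times the kernel of I - G for \<open>t \<le> q\<close>. The bound 5/6 for
  \<open>q\<close> serves twice: it gives \<open>q - t \<le> q * w\<close> with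
  \<open>w = 1 - 6/5 * t\<close>, and it absorbs the factor \<open>6/5 * q\<close> left over from
  \<open>q^5 = 9/25 * q\<close>.\<close>

lemma gauss_kernel_nonneg:
  fixes t q :: real
  assumes "0 \<le> t" "t \<le> q" "0 \<le> q" and q2: "q^2 = 3/5"
  shows "10/3 * (q - t)^5 \<le> (1 - t)^6"
proof -
  have q: "q \<le> 5/6"
    by (rule power2_le_imp_le) (auto simp: q2 power_divide)
  have "q - t \<le> q * (1 - 6/5 * t)"
    using mult_right_mono[OF q \<open>0 \<le> t\<close>] by (simp add: algebra_simps)
  then have "(q - t)^5 \<le> (q * (1 - 6/5 * t))^5"
    using assms by (intro power_mono) auto
  moreover have "q^5 = 9/25 * q"
  proof -
    have "q^5 = (q^2)^2 * q" by (simp add: eval_nat_numeral)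
    then show ?thesis unfolding q2 by (simp add: power_divide)
  qed
  ultimately have 1: "10/3 * (q - t)^5 \<le> 6/5 * q * (1 - 6/5 * t)^5"
    by (simp add: power_mult_distrib)
  define w where "w = 1 - 6/5 * t"
  have "0 \<le> q * w"
    using \<open>q - t \<le> q * (1 - 6/5 * t)\<close> \<open>t \<le> q\<close> unfolding w_def by linarith
  moreover have "q > 0" using assms(3) q2 by (cases "q = 0") auto
  ultimately have w: "0 \<le> w" by (simp add: zero_le_mult_iff)
  have "6/5 * q * w^5 \<le> w^5"
    using mult_right_mono[of "6/5 * q" 1 "w^5"] q w by simp
  \<comment> \<open>AM-GM for five copies of \<open>w\<close> and one copy of 1.\<close>
  also have "w^5 \<le> ((5 * w + 1) / 6)^6"
  proof -
    \<comment> \<open>Equality at \<open>w = 1\<close> gives the double root; the cofactor has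
      positive coefficients.\<close>
    have "((5 * w + 1) / 6)^6 - w^5
      = (w - 1)^2 * (15625 * w^4 + 3344 * w^3 + 438 * w^2 + 32 * w + 1) / 46656"
      by (simp add: field_simps eval_nat_numeral)
    also have "\<dots> \<ge> 0" using w by simp
    finally show ?thesis by simp
  qed
  also have "(5 * w + 1) / 6 = 1 - t" by (simp add: w_def)
  finally show ?thesis using 1 by (simp add: w_def)
qed

text \<open>A lower bound for the next kernel on [0, 1/2], its irrational coefficients rounded down.
  Estimating \<open>t^2\<close> and \<open>t^6\<close> leaves a comparison of \<open>t^4\<close>
  with \<open>t^5\<close> and a constant.\<close>

lemma averaged_kernel_pos_polynomial:
  fixes t :: real
  assumes "0 \<le> t" "t \<le> 1/2"
  shows "0 \<le> 565/10000 - 114/1000 * t^2 - 275/100 * t^4 + 8 * t^5 - 6 * t^6"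
proof -
  have 1: "t^2 \<le> 1/4" using power_mono[OF assms(2,1), of 2] by (simp add: power2_eq_square)
  have 2: "2 * t^6 \<le> t^5"
    using mult_right_mono[of "2 * t" 1 "t^5"] assms by (simp add: eval_nat_numeral)
  \<comment> \<open>AM-GM for four copies of \<open>t^5\<close> and one of \<open>s^5\<close>; the
    value of \<open>s\<close> makes \<open>5/4 * 5 * s\<close> equal to the coefficient
    275/100.\<close>
  define s :: real where "s = 11/25"
  have "4 * t^5 + s^5 - 5 * t^4 * s = (t - s)^2 * (4 * t^3 + 3 * t^2 * s + 2 * t * s^2 + s^3)"
    by (simp add: algebra_simps eval_nat_numeral)
  also have "\<dots> \<ge> 0" using assms by (simp add: s_def)
  finally have 3: "4 * t^5 + s^5 - 5 * t^4 * s \<ge> 0" .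
  have "s^5 \<le> 17/1000" by (simp add: s_def eval_nat_numeral)
  with 3 have "4 * t^5 + 17/1000 - 11/5 * t^4 \<ge> 0" by (simp add: s_def)
  with 1 2 show ?thesis by linarith
qed

text \<open>This is 2160 times the kernel of G + L - 2 I, with \<open>p\<close> and \<open>q\<close>
  the positive inner nodes of Lobatto and Gauss. Beyond 1/2 the endpoint term alone suffices,
  because \<open>6 * (1 - t) \<le> 3\<close>; below it the kernel is bounded by a
  polynomial.\<close>

lemma averaged_kernel_nonneg:
  fixes t p q :: real
  assumes t: "0 \<le> t" "t \<le> 1" and p: "0 \<le> p" "p^2 = 1/5" and q: "0 \<le> q" "q^2 = 3/5"
  shows "6 * (1 - t)^6 \<le> 3 * (1 - t)^5 + 10 * (max 0 (q - t))^5 + 15 * (max 0 (p - t))^5"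
proof (cases "t \<le> 1/2")
  case True
  \<comment> \<open>After expansion no coefficient decreases as \<open>p\<close> or \<open>q\<close>
    grows, so lower bounds suffice. Four decimals keep the constant term, about 0.0565,
    positive.\<close>
  have p_low: "p \<ge> 4472/10000" by (rule power2_le_imp_le) (auto simp: p power_divide)
  have q_low: "q \<ge> 7745/10000" by (rule power2_le_imp_le) (auto simp: q power_divide)
  have powers: "x^3 = x^2 * x" "x^4 = (x^2)^2" "x^5 = (x^2)^2 * x" for x :: real
    by (simp_all flip: power_mult power_Suc2)
  have p_powers: "p^3 = p/5" "p^4 = 1/25" "p^5 = p/25"
    unfolding powers p(2) by (simp_all add: power2_eq_square)
  have q_powers: "q^3 = 3*q/5" "q^4 = 9/25" "q^5 = 9*q/25"
    unfolding powers q(2) by (simp_all add: power2_eq_square)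
  have odd_power_mono: "x^5 \<le> (max 0 x)^5" for x :: real
    by (rule power_mono_odd) auto
  have binom: "(x - t)^5 = x^5 - 5*x^4*t + 10*x^3*t^2 - 10*x^2*t^3 + 5*x*t^4 - t^5" for x
    by (simp add: algebra_simps eval_nat_numeral)
  \<comment> \<open>Dropping the truncations only lowers the kernel; exactness of both rules for low degrees
    cancels the terms in \<open>t\<close> and \<open>t^3\<close>.\<close>
  have "3 * (1 - t)^5 - 6 * (1 - t)^6 + 10 * (q - t)^5 + 15 * (p - t)^5
    = (-3 + 18/5*q + 3/5*p) + (-60 + 60*q + 30*p) * t^2 + (-75 + 50*q + 75*p) * t^4 + 8*t^5 - 6*t^6"
    unfolding binom p(2) q(2) p_powers q_powers
    by (simp add: algebra_simps eval_nat_numeral)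
  moreover have "(-60 + 60*q + 30*p) * t^2 \<ge> - (114/1000) * t^2"
    using p_low q_low by (intro mult_right_mono) auto
  moreover have "(-75 + 50*q + 75*p) * t^4 \<ge> - (275/100) * t^4"
    using p_low q_low by (intro mult_right_mono) auto
  ultimately show ?thesis
    using averaged_kernel_pos_polynomial[OF t(1) True] p_low q_low
      odd_power_mono[of "p - t"] odd_power_mono[of "q - t"] by linarith
next
  case False
  then have "0 \<le> (1 - t)^5 * (2 * t - 1)" using t by simp
  then have "6 * (1 - t)^6 \<le> 3 * (1 - t)^5" by (simp add: algebra_simps eval_nat_numeral)
  then show ?thesis by (simp add: add_increasing2)
qed

subsection \<open>A single interval\<close>

text \<open>Truncating the power extends the Taylor remainder from \<open>{0..q}\<close> to
  \<open>{0..1}\<close>, so that the remainders of different nodes combine into one kernel.\<close>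

lemma taylor_truncated_power:
  fixes D :: "nat \<Rightarrow> real \<Rightarrow> real"
  assumes "0 \<le> q" "q \<le> 1" "n > 0"
    and "\<And>j s. j \<le> n \<Longrightarrow> s \<in> {0..1} \<Longrightarrow>
      (D j has_real_derivative D (Suc j) s) (at s within {0..1})"
  shows "((\<lambda>t. (max 0 (q - t))^n / fact n * D (Suc n) t)
    has_integral D 0 q - (\<Sum>i<Suc n. q^i / fact i * D i 0)) {0..1}"
proof -
  have sub: "{0..q} \<subseteq> {0..1::real}" using assms by auto
  have "((\<lambda>t. ((q - t)^(Suc n - 1) / fact (Suc n - 1)) *\<^sub>R D (Suc n) t)
    has_integral D 0 q - (\<Sum>i<Suc n. ((q - 0)^i / fact i) *\<^sub>R D i 0)) {0..q}"
  proof (rule Taylor_has_integral)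
    show "(D m has_vector_derivative D (Suc m) t) (at t within {0..q})"
      if "m < Suc n" "0 \<le> t" "t \<le> q" for m t
      using has_field_derivative_subset[OF assms(4) sub, of m t] that assms(2)
      by (simp add: has_real_derivative_iff_has_vector_derivative)
  qed (use assms in auto)
  then have "((\<lambda>t. if t \<in> {0..q} then (q - t)^n / fact n * D (Suc n) t else 0)
    has_integral D 0 q - (\<Sum>i<Suc n. q^i / fact i * D i 0)) {0..1}"
    by (subst has_integral_restrict[OF sub]) simp
  \<comment> \<open>Beyond \<open>q\<close> the truncated power is \<open>0^n\<close>, which
    vanishes because \<open>n > 0\<close>.\<close>
  then show ?thesis
    by (rule has_integral_eq[rotated]) (use assms in \<open>auto simp: max_def\<close>)
qed

text \<open>Here \<open>D 0\<close> is an antiderivative of the folded integrand \<open>D 1\<close>.\<close>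

lemma gauss_lobatto_folded:
  fixes D :: "nat \<Rightarrow> real \<Rightarrow> real" and p q :: real
  assumes deriv: "\<And>j s. j \<le> 6 \<Longrightarrow> s \<in> {0..1} \<Longrightarrow>
      (D j has_real_derivative D (Suc j) s) (at s within {0..1})"
    and even: "D 0 0 = 0" "D 2 0 = 0" "D 4 0 = 0" "D 6 0 = 0"
    and nonneg: "\<And>s. s \<in> {0..1} \<Longrightarrow> D 7 s \<ge> 0"
    and p: "0 \<le> p" "p^2 = 1/5" and q: "0 \<le> q" "q^2 = 3/5"
  shows "(5 * D 1 q + 4 * D 1 0) / 9 \<le> D 0 1" (is "?G \<le> _")
    and "2 * D 0 1 \<le> (5 * D 1 q + 4 * D 1 0) / 9 + (D 1 1 + 5 * D 1 p) / 6" (is "_ \<le> _ + ?L")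
proof -
  \<comment> \<open>Remainder integrand and fifth-order Taylor polynomial of \<open>D 1\<close>; the
    assumptions \<open>even\<close> remove the odd powers.\<close>
  let ?R = "\<lambda>x t. (max 0 (x - t))^5 / 120 * D 7 t"
  let ?T = "\<lambda>x. D 1 0 + x^2 / 2 * D 3 0 + x^4 / 24 * D 5 0"
  have node: "(?R x has_integral D 1 x - ?T x) {0..1}" if "0 \<le> x" "x \<le> 1" for x
  proof -
    have eqs: "(\<Sum>i<Suc 5. x^i / fact i * D (Suc i) 0) = ?T x"
      using even by (simp add: eval_nat_numeral)
    have "((\<lambda>t. (max 0 (x - t))^5 / fact 5 * D (Suc (Suc 5)) t)
      has_integral D (Suc 0) x - (\<Sum>i<Suc 5. x^i / fact i * D (Suc i) 0)) {0..1}"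
      by (rule taylor_truncated_power[where D = "\<lambda>i. D (Suc i)"]) (use that deriv in auto)
    then show ?thesis unfolding eqs by (simp add: fact_numeral)
  qed
  \<comment> \<open>Starting from the antiderivative raises the order by one, so this remainder also
    contains \<open>D 7\<close> and can be compared with \<open>?R\<close> pointwise.\<close>
  have int: "((\<lambda>t. (1 - t)^6 / 720 * D 7 t) has_integral
    D 0 1 - (D 1 0 + D 3 0 / 6 + D 5 0 / 120)) {0..1}"
  proof -
    have eqs: "(\<Sum>i<Suc 6. 1^i / fact i * D i 0) = D 1 0 + D 3 0 / 6 + D 5 0 / 120"
      using even by (simp add: eval_nat_numeral)
    have "((\<lambda>t. (max 0 (1 - t))^6 / fact 6 * D (Suc 6) t)
      has_integral D 0 1 - (\<Sum>i<Suc 6. 1^i / fact i * D i 0)) {0..1}"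
      by (rule taylor_truncated_power) (use deriv in auto)
    then have "((\<lambda>t. (max 0 (1 - t))^6 / 720 * D 7 t)
      has_integral D 0 1 - (D 1 0 + D 3 0 / 6 + D 5 0 / 120)) {0..1}"
      unfolding eqs by (simp add: fact_numeral)
    then show ?thesis by (rule has_integral_eq[rotated]) auto
  qed
  have "p \<le> 1" by (rule power2_le_imp_le) (auto simp: p)
  have "q \<le> 1" by (rule power2_le_imp_le) (auto simp: q)
  have fourth_power: "x^4 = (x^2)^2" for x :: real
    by (simp flip: power_mult)
  have p4: "p^4 = 1/25" and q4: "q^4 = 9/25"
    unfolding fourth_power p(2) q(2) by (simp_all add: power2_eq_square)
  note Rp = node[OF p(1) \<open>p \<le> 1\<close>] and Rq = node[OF q(1) \<open>q \<le> 1\<close>]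
  \<comment> \<open>The central node 0 contributes no remainder, so only \<open>q\<close>, with
    weight 5/9, enters the Gauss kernel.\<close>
  have "((\<lambda>t. (1 - t)^6 / 720 * D 7 t - 5/9 * ?R q t) has_integral
    (D 0 1 - (D 1 0 + D 3 0 / 6 + D 5 0 / 120)) - 5/9 * (D 1 q - ?T q)) {0..1}"
    by (intro has_integral_diff has_integral_mult_right int Rq)
  then have "0 \<le> (D 0 1 - (D 1 0 + D 3 0 / 6 + D 5 0 / 120)) - 5/9 * (D 1 q - ?T q)"
  proof (rule has_integral_nonneg)
    fix t :: real assume t: "t \<in> {0..1}"
    have "10/3 * (max 0 (q - t))^5 \<le> (1 - t)^6"
      using gauss_kernel_nonneg[of t q] t q by (cases "t \<le> q") (auto simp: max_def)
    then have "0 \<le> ((1 - t)^6 - 10/3 * (max 0 (q - t))^5) / 720 * D 7 t"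
      using nonneg[OF t] by simp
    then show "0 \<le> (1 - t)^6 / 720 * D 7 t - 5/9 * ?R q t"
      by (simp add: algebra_simps diff_divide_distrib)
  qed
  \<comment> \<open>Exactness for degree 5 cancels \<open>D 3 0\<close> and \<open>D 5 0\<close>;
    what remains of \<open>D 1 0\<close> is the central weight 4/9.\<close>
  then show "?G \<le> D 0 1" by (simp add: q(2) q4 field_simps)
  \<comment> \<open>The kernels of both rules minus twice that of the integral; 2160 will be the
    common denominator.\<close>
  have "((\<lambda>t. 5/9 * ?R q t + (1/6 * ?R 1 t + 5/6 * ?R p t) - 2 * ((1 - t)^6 / 720 * D 7 t)) has_integral
    5/9 * (D 1 q - ?T q) + (1/6 * (D 1 1 - ?T 1) + 5/6 * (D 1 p - ?T p))
      - 2 * (D 0 1 - (D 1 0 + D 3 0 / 6 + D 5 0 / 120))) {0..1}"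
    by (intro has_integral_add has_integral_diff has_integral_mult_right int Rp Rq node) auto
  then have "0 \<le> 5/9 * (D 1 q - ?T q) + (1/6 * (D 1 1 - ?T 1) + 5/6 * (D 1 p - ?T p))
      - 2 * (D 0 1 - (D 1 0 + D 3 0 / 6 + D 5 0 / 120))"
  proof (rule has_integral_nonneg)
    fix t :: real assume t: "t \<in> {0..1}"
    have "0 \<le> (3 * (1 - t)^5 + 10 * (max 0 (q - t))^5 + 15 * (max 0 (p - t))^5 - 6 * (1 - t)^6)
        / 2160 * D 7 t"
      using averaged_kernel_nonneg[of t p q] nonneg[OF t] t p q by simp
    moreover have "max 0 (1 - t) = 1 - t" using t by simp
    ultimately show "0 \<le> 5/9 * ?R q t + (1/6 * ?R 1 t + 5/6 * ?R p t) - 2 * ((1 - t)^6 / 720 * D 7 t)"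
      by (simp add: algebra_simps add_divide_distrib diff_divide_distrib)
  qed
  then show "2 * D 0 1 \<le> ?G + ?L" by (simp add: p(2) q(2) p4 q4 field_simps)
qed

text \<open>Rescales to \<open>{0..1}\<close> and folds at the midpoint. The antiderivative is
  folded too, so that the integral becomes the value \<open>E 0 1\<close>.\<close>

lemma gauss_lobatto_interval:
  fixes c d :: real
  assumes "c < d"
    and deriv: "\<And>j x. j < 6 \<Longrightarrow> x \<in> {c..d} \<Longrightarrow>
      (D j has_real_derivative D (Suc j) x) (at x within {c..d})"
    and nonneg: "\<And>x. x \<in> {c..d} \<Longrightarrow> D 6 x \<ge> 0"
  shows "gauss3 (D 0) c d \<le> integral {c..d} (D 0)"
    and "2 * integral {c..d} (D 0) \<le> gauss3 (D 0) c d + lobatto4 (D 0) c d"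
proof -
  \<comment> \<open>Prepending the antiderivative shifts the indices by one: \<open>F 7\<close> is
    \<open>D 6\<close>.\<close>
  define F where "F = case_nat (\<lambda>x. integral {c..x} (D 0)) D"
  define m r where "m = (c + d) / 2" and "r = (d - c) / 2"
  \<comment> \<open>\<open>E j\<close> is the \<open>j\<close>-th derivative of the integral from
    \<open>m - r * s\<close> to \<open>m + r * s\<close>. The sign \<open>(-1)^j\<close> comes from
    the chain rule and makes \<open>E j 0\<close> vanish for even \<open>j\<close>.\<close>
  define E where "E = (\<lambda>j s. r^j * (F j (m + r * s) - (-1)^j * F j (m - r * s)))"
  have "r > 0" and mr: "m + r = d" "m - r = c" using \<open>c < d\<close> by (auto simp: m_def r_def field_simps)
  have cont: "continuous_on {c..d} (D 0)"
    using DERIV_continuous_on[of "{c..d}" "D 0" "D (Suc 0)"] deriv[of 0] by simp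
  have F: "(F j has_real_derivative F (Suc j) x) (at x within {c..d})" if "j \<le> 6" "x \<in> {c..d}" for j x
    using that deriv integral_has_real_derivative[OF cont] by (cases j) (auto simp: F_def)
  have in_cd: "m + r * s \<in> {c..d}" "m - r * s \<in> {c..d}" if "s \<in> {0..1}" for s
  proof -
    have "0 \<le> r * s" "r * s \<le> r" using that \<open>r > 0\<close> by (auto simp: mult_left_le)
    then show "m + r * s \<in> {c..d}" "m - r * s \<in> {c..d}" using \<open>r > 0\<close> mr by auto
  qed
  have E: "(E j has_real_derivative E (Suc j) s) (at s within {0..1})" if "j \<le> 6" "s \<in> {0..1}" for j s
  proof -
    have chain: "((\<lambda>s. F j (m + e * s)) has_real_derivative F (Suc j) (m + e * s) * e) (at s within {0..1})"
      if e: "\<And>s. s \<in> {0..1} \<Longrightarrow> m + e * s \<in> {c..d}" for e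
    proof -
      have "(F j has_real_derivative F (Suc j) (m + e * s)) (at (m + e * s) within (\<lambda>s. m + e * s) ` {0..1})"
        using F[OF \<open>j \<le> 6\<close> e[OF \<open>s \<in> {0..1}\<close>]] by (rule has_field_derivative_subset) (use e in auto)
      moreover have "((\<lambda>s. m + e * s) has_real_derivative e) (at s within {0..1})"
        by (auto intro!: derivative_eq_intros)
      ultimately have "(F j \<circ> (\<lambda>s. m + e * s) has_real_derivative F (Suc j) (m + e * s) * e) (at s within {0..1})"
        by (rule DERIV_image_chain)
      then show ?thesis by (simp add: o_def)
    qed
    have "(E j has_real_derivative r^j * (F (Suc j) (m + r * s) * r - (-1)^j * (F (Suc j) (m + - r * s) * - r)))
        (at s within {0..1})"
      using DERIV_cmult[OF DERIV_diff[OF chain[of r] DERIV_cmult[OF chain[of "- r"], of "(-1)^j"]], of "r^j"] in_cd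
      by (simp add: E_def)
    then show ?thesis by (simp add: E_def algebra_simps)
  qed
  \<comment> \<open>The odd index turns the difference into a sum of two values of
    \<open>D 6\<close>.\<close>
  have E7: "E 7 s \<ge> 0" if "s \<in> {0..1}" for s
    using nonneg in_cd[OF that] \<open>r > 0\<close> by (simp add: E_def F_def eval_nat_numeral)
  define p q :: real where "p = sqrt 5 / 5" and "q = sqrt 15 / 5"
  have p: "0 \<le> p" "p^2 = 1/5" and q: "0 \<le> q" "q^2 = 3/5"
    by (simp_all add: p_def q_def power_divide)
  have E1: "E 1 s = r * (D 0 (m + r * s) + D 0 (m - r * s))" for s
    by (simp add: E_def F_def)
  have E0: "E 0 1 = integral {c..d} (D 0)"
    by (simp add: E_def F_def mr)
  have G: "gauss3 (D 0) c d = (5 * E 1 q + 4 * E 1 0) / 9"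
  proof -
    have nodes: "(5 + sqrt 15) / 10 * c + (5 - sqrt 15) / 10 * d = m - r * q"
      "(5 - sqrt 15) / 10 * c + (5 + sqrt 15) / 10 * d = m + r * q" "(c + d) / 2 = m"
      by (simp_all add: m_def r_def q_def field_simps)
    show ?thesis unfolding gauss3_def nodes E1 by (simp add: r_def field_simps)
  qed
  have L: "lobatto4 (D 0) c d = (E 1 1 + 5 * E 1 p) / 6"
  proof -
    have nodes: "(5 + sqrt 5) / 10 * c + (5 - sqrt 5) / 10 * d = m - r * p"
      "(5 - sqrt 5) / 10 * c + (5 + sqrt 5) / 10 * d = m + r * p"
      by (simp_all add: m_def r_def p_def field_simps)
    show ?thesis unfolding lobatto4_def nodes E1 by (simp add: mr) (simp add: r_def field_simps)
  qed
  have even: "E 0 0 = 0" "E 2 0 = 0" "E 4 0 = 0" "E 6 0 = 0"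
    by (simp_all add: E_def)
  note folded = gauss_lobatto_folded[of E p q, OF E even E7 p q]
  show "gauss3 (D 0) c d \<le> integral {c..d} (D 0)"
    unfolding G E0[symmetric] by (rule folded(1))
  show "2 * integral {c..d} (D 0) \<le> gauss3 (D 0) c d + lobatto4 (D 0) c d"
    unfolding G L E0[symmetric] by (rule folded(2))
qed

subsection \<open>Composite rules\<close>

lemma grid_point_less:
  assumes "a < b" "i < j" "j \<le> n"
  shows "grid_point n a b i < grid_point n a b j"
proof -
  have "real i * (b - a) < real j * (b - a)" using assms by simp
  then show ?thesis using assms by (simp add: grid_point_def divide_strict_right_mono)
qed

lemma grid_point_le:
  assumes "a < b" "i \<le> j" "j \<le> n"
  shows "grid_point n a b i \<le> grid_point n a b j"
  using grid_point_less[of a b i j n] assms by (cases "i = j") auto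

text \<open>Treating the exact integral as a rule lets it be compared with the quadrature rules
  termwise.\<close>

lemma integral_eq_composite:
  assumes "a < b" "n \<ge> 1" "f integrable_on {a..b}"
  shows "integral {a..b} f = composite (\<lambda>f c d. integral {c..d} f) n f a b"
proof -
  let ?x = "grid_point n a b"
  have ends: "?x 0 = a" "?x n = b" using assms by (simp_all add: grid_point_def)
  have mono: "?x i \<le> ?x j" if "i \<le> j" "j \<le> n" for i j
    using grid_point_le[OF assms(1) that] .
  have "integral {a..?x k} f = (\<Sum>i=1..k. integral {?x (i - 1)..?x i} f)" if "k \<le> n" for k
    using that
  proof (induction k)
    case 0
    then show ?case by (simp add: ends)
  next
    case (Suc k)
    have "f integrable_on {a..?x (Suc k)}"
      using mono[of "Suc k" n] Suc.prems ends
      by (intro integrable_on_subinterval[OF assms(3)]) auto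
    then have "integral {a..?x k} f + integral {?x k..?x (Suc k)} f = integral {a..?x (Suc k)} f"
      using mono[of 0 k] mono[of k "Suc k"] Suc.prems ends
      by (intro Henstock_Kurzweil_Integration.integral_combine) auto
    then show ?case using Suc by simp
  qed
  from this[of n] show ?thesis by (simp add: composite_def ends)
qed

lemma composite_bounds:
  fixes a b :: real
  assumes "a < b" "n \<ge> 1"
    and deriv: "\<And>j x. j < 6 \<Longrightarrow> x \<in> {a..b} \<Longrightarrow>
      (D j has_real_derivative D (Suc j) x) (at x within {a..b})"
    and nonneg: "\<And>x. x \<in> {a..b} \<Longrightarrow> D 6 x \<ge> 0"
  shows "composite gauss3 n (D 0) a b \<le> integral {a..b} (D 0)"
    and "2 * integral {a..b} (D 0) \<le> composite gauss3 n (D 0) a b + composite lobatto4 n (D 0) a b"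
proof -
  let ?x = "grid_point n a b"
  have "continuous_on {a..b} (D 0)"
    using DERIV_continuous_on[of "{a..b}" "D 0" "D (Suc 0)"] deriv[of 0] by simp
  then have int: "integral {a..b} (D 0) = composite (\<lambda>f c d. integral {c..d} f) n (D 0) a b"
    by (intro integral_eq_composite assms integrable_continuous_interval)
  have local: "gauss3 (D 0) (?x (k - 1)) (?x k) \<le> integral {?x (k - 1)..?x k} (D 0)"
    "2 * integral {?x (k - 1)..?x k} (D 0)
      \<le> gauss3 (D 0) (?x (k - 1)) (?x k) + lobatto4 (D 0) (?x (k - 1)) (?x k)"
    if k: "k \<in> {1..n}" for k
  proof -
    have ends: "?x 0 = a" "?x n = b" using assms by (simp_all add: grid_point_def)
    \<comment> \<open>Here \<open>k \<ge> 1\<close>, so \<open>k - 1\<close> is a true predecessor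
      in spite of truncated subtraction.\<close>
    have lt: "?x (k - 1) < ?x k" using grid_point_less[OF assms(1), of "k - 1" k n] k by auto
    have "a \<le> ?x (k - 1)" using grid_point_le[OF assms(1), of 0 "k - 1" n] k ends by auto
    moreover have "?x k \<le> b" using grid_point_le[OF assms(1), of k n n] k ends by auto
    ultimately have sub: "{?x (k - 1)..?x k} \<subseteq> {a..b}" by auto
    have der: "(D j has_real_derivative D (Suc j) x) (at x within {?x (k - 1)..?x k})"
      if "j < 6" "x \<in> {?x (k - 1)..?x k}" for j x
      using has_field_derivative_subset[OF deriv sub] that sub by blast
    have nn: "D 6 x \<ge> 0" if "x \<in> {?x (k - 1)..?x k}" for x
      using nonneg that sub by blast
    note bounds = gauss_lobatto_interval[of _ _ D, OF lt der nn]
    show "gauss3 (D 0) (?x (k - 1)) (?x k) \<le> integral {?x (k - 1)..?x k} (D 0)"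
      by (rule bounds(1))
    show "2 * integral {?x (k - 1)..?x k} (D 0)
      \<le> gauss3 (D 0) (?x (k - 1)) (?x k) + lobatto4 (D 0) (?x (k - 1)) (?x k)"
      by (rule bounds(2))
  qed
  show "composite gauss3 n (D 0) a b \<le> integral {a..b} (D 0)"
    unfolding int composite_def by (rule sum_mono) (rule local(1))
  show "2 * integral {a..b} (D 0) \<le> composite gauss3 n (D 0) a b + composite lobatto4 n (D 0) a b"
    unfolding int composite_def sum_distrib_left sum.distrib[symmetric]
    by (rule sum_mono) (rule local(2))
qed

text \<open>The average is the midpoint between G and (G + L) / 2, and half their distance is a
  quarter of the distance from G to L. The second alternative serves the concave case.\<close>

lemma abs_diff_average_le:
  fixes I G L :: real
  assumes "G \<le> I \<and> 2 * I \<le> G + L \<or> I \<le> G \<and> G + L \<le> 2 * I"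
  shows "\<bar>I - (3/4 * G + 1/4 * L)\<bar> \<le> 1/4 * \<bar>L - G\<bar>"
  using assms by (auto simp: abs_if)

lemma composite_quad_Q:
  "composite quad_Q n f a b = 3/4 * composite gauss3 n f a b + 1/4 * composite lobatto4 n f a b"
  unfolding composite_def quad_Q_def sum.distrib sum_distrib_left ..

lemma composite_uminus:
  "composite gauss3 n (\<lambda>t. - f t) a b = - composite gauss3 n f a b"
  "composite lobatto4 n (\<lambda>t. - f t) a b = - composite lobatto4 n f a b"
proof -
  have "gauss3 (\<lambda>t. - f t) c d = - gauss3 f c d" "lobatto4 (\<lambda>t. - f t) c d = - lobatto4 f c d" for c d
    unfolding gauss3_def lobatto4_def minus_mult_right by simp_all
  then show "composite gauss3 n (\<lambda>t. - f t) a b = - composite gauss3 n f a b"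
    "composite lobatto4 n (\<lambda>t. - f t) a b = - composite lobatto4 n f a b"
    by (simp_all add: composite_def sum_negf)
qed

theorem theorem3:
  fixes a b :: real and f :: "real \<Rightarrow> real" and n :: nat
  assumes "a < b"
    and "Ck_on 6 {a..b} f"
    and "higher_convex_on 5 {a..b} f \<or> higher_concave_on 5 {a..b} f"
    and "n \<ge> 1"
  shows "\<bar>integral {a..b} f - composite quad_Q n f a b\<bar>
      \<le> 1 / 4 * \<bar>composite lobatto4 n f a b - composite gauss3 n f a b\<bar>"
proof -
  obtain D where D0: "D 0 = f"
    and deriv: "\<And>j x. j < 6 \<Longrightarrow> x \<in> {a..b} \<Longrightarrow>
      (D j has_real_derivative D (Suc j) x) (at x within {a..b})"
    and cont: "continuous_on {a..b} (D 6)"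
    using Ck_on_derivatives[OF assms(2)] by blast
  from assms(3) show ?thesis
  proof
    assume "higher_convex_on 5 {a..b} f"
    then have nonneg: "D 6 x \<ge> 0" if "x \<in> {a..b}" for x
      using higher_convex_on_imp_deriv_nonneg[of a b 5 D] assms(1) deriv cont that by (simp add: D0)
    note bounds = composite_bounds[of a b n D, OF assms(1,4) deriv nonneg, unfolded D0]
    have "composite gauss3 n f a b \<le> integral {a..b} f"
      by (rule bounds(1))
    moreover have "2 * integral {a..b} f \<le> composite gauss3 n f a b + composite lobatto4 n f a b"
      by (rule bounds(2))
    ultimately show ?thesis unfolding composite_quad_Q by (intro abs_diff_average_le) simp_all
  next
    assume concave: "higher_concave_on 5 {a..b} f"
    \<comment> \<open>The convex bounds hold for \<open>- f\<close>; since the integral and the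
      rules change sign with the function, both inequalities reverse for \<open>f\<close>.\<close>
    define E where "E = (\<lambda>j t. - D j t)"
    have E0: "E 0 = (\<lambda>t. - f t)" by (simp add: E_def D0)
    have derivE: "(E j has_real_derivative E (Suc j) x) (at x within {a..b})"
      if "j < 6" "x \<in> {a..b}" for j x
      unfolding E_def by (rule DERIV_minus[OF deriv[OF that]])
    have "continuous_on {a..b} (E 6)" unfolding E_def using cont by (rule continuous_on_minus)
    then have nonneg: "E 6 x \<ge> 0" if "x \<in> {a..b}" for x
      using higher_convex_on_imp_deriv_nonneg[of a b 5 E] assms(1) derivE concave that
      by (simp add: E0 higher_concave_on_def)
    note bounds = composite_bounds[of a b n E, OF assms(1,4) derivE nonneg,
        unfolded E0 composite_uminus integral_neg]
    have "- composite gauss3 n f a b \<le> - integral {a..b} f"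
      by (rule bounds(1))
    moreover have "2 * - integral {a..b} f \<le> - composite gauss3 n f a b + - composite lobatto4 n f a b"
      by (rule bounds(2))
    ultimately show ?thesis unfolding composite_quad_Q by (intro abs_diff_average_le) simp_all
  qed
qed

end
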